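(* Let $R=K[x_1,\dots,x_n]$ be a polynomial ring over a field $K$ and let $I\subset R$ be a (nonzero, proper) symmetric monomial ideal, i.e. a monomial ideal fixed by the action of $\mathfrak S_n$ permuting the variables. Then the radical $\sqrt I$ is symmetric strongly shifted and is described as $$\sqrt I=\bigcap_{1\le i_1<\cdots<i_c\le n}(x_{i_1},\dots,x_{i_c})=I_{n,c},\qquad\text{where }c=\mathrm{ht}(I).$$
   Context: $P_n=\{\lambda\in\mathbb Z^n: 0\le\lambda_1\le\cdots\le\lambda_n\}$, $x^\lambda=x_1^{\lambda_1}\cdots x_n^{\lambda_n}$. For an $\mathfrak S_n$-fixed monomial ideal $I$ put $P(I)=\{\lambda\in P_n: x^\lambda\in I\}$. An $\mathfrak S_n$-fixed monomial ideal $I$ is symmetric strongly shifted if for every $\lambda\in P(I)$ and $1\le i<j\le n$ with $\lambda_i<\lambda_j$ one has $x^\lambda x_i/x_j\in I$. $I_{n,c}$ denotes the ideal $\bigcap_{1\le i_1<\cdots<i_c\le n}(x_{i_1},\dots,x_{i_c})$ (the square-free Veronese ideal of degree $n-c+1$). *)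

theory Defs
  imports "HOL-Algebra.Algebra" "HOL-Library.Poly_Mapping" "HOL-Library.Extended_Nat"
begin

text \<open>Polynomials in the variables \<open>x\<^sub>0, x\<^sub>1, \<dots>\<close> are finitely supported coefficient functions on
  exponent vectors \<open>\<lambda>\<close>, the latter being finitely supported functions from indices to exponents;
  multiplication is the convolution product of \<^theory>\<open>HOL-Library.Poly_Mapping\<close>.
  The ring \<open>K[x\<^sub>1,\<dots>,x\<^sub>n]\<close> consists of those in which only variables with index in
  \<open>{1..n}\<close> occur.\<close>

type_synonym 'k mpoly = "(nat \<Rightarrow>\<^sub>0 nat) \<Rightarrow>\<^sub>0 'k"

definition mpoly_ring :: "nat \<Rightarrow> 'k::field mpoly ring" where
  "mpoly_ring n = \<lparr>carrier = {p. \<forall>m \<in> Poly_Mapping.keys p. Poly_Mapping.keys m \<subseteq> {1..n}},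
     monoid.mult = (*), one = 1, ring.zero = 0, ring.add = (+)\<rparr>"

definition monom_of :: "(nat \<Rightarrow>\<^sub>0 nat) \<Rightarrow> 'k::field mpoly" where
  "monom_of m = Poly_Mapping.single m 1"

definition var :: "nat \<Rightarrow> 'k::field mpoly" where
  "var i = monom_of (Poly_Mapping.single i 1)"

definition monomial_ideal :: "nat \<Rightarrow> 'k::field mpoly set \<Rightarrow> bool" where
  "monomial_ideal n I \<longleftrightarrow>
     (\<exists>M. (\<forall>m \<in> M. Poly_Mapping.keys m \<subseteq> {1..n}) \<and> I = Idl\<^bsub>mpoly_ring n\<^esub> (monom_of ` M))"

text \<open>The action of a permutation of the variables, \<open>x\<^sub>i \<mapsto> x\<^bsub>\<sigma> i\<^esub>\<close>: the coefficient of
  \<open>\<sigma> \<cdot> p\<close> at \<open>\<lambda>\<close> is the coefficient of \<open>p\<close> at \<open>\<lambda> \<circ> \<sigma>\<close>; compare \<open>perm_act_single\<close> and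
  \<open>perm_act_var\<close> below.\<close>

definition perm_act :: "(nat \<Rightarrow> nat) \<Rightarrow> 'k::field mpoly \<Rightarrow> 'k mpoly" where
  "perm_act \<sigma> p = Poly_Mapping.map_key (Poly_Mapping.map_key \<sigma>) p"

definition symmetric_monomial_ideal :: "nat \<Rightarrow> 'k::field mpoly set \<Rightarrow> bool" where
  "symmetric_monomial_ideal n I \<longleftrightarrow>
     monomial_ideal n I \<and> (\<forall>\<sigma>. \<sigma> permutes {1..n} \<longrightarrow> perm_act \<sigma> ` I = I)"

definition partitions :: "nat \<Rightarrow> (nat \<Rightarrow>\<^sub>0 nat) set" where
  "partitions n = {m. Poly_Mapping.keys m \<subseteq> {1..n} \<and>
     (\<forall>i j. 1 \<le> i \<longrightarrow> i \<le> j \<longrightarrow> j \<le> n \<longrightarrow> Poly_Mapping.lookup m i \<le> Poly_Mapping.lookup m j)}"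

definition partitions_of_ideal :: "nat \<Rightarrow> 'k::field mpoly set \<Rightarrow> (nat \<Rightarrow>\<^sub>0 nat) set" where
  "partitions_of_ideal n I = {m \<in> partitions n. monom_of m \<in> I}"

text \<open>In the exponent of \<open>x\<^sup>\<lambda> x\<^sub>i / x\<^sub>j\<close> the pointwise truncated subtraction is exact, because
  \<open>\<lambda>\<^sub>i < \<lambda>\<^sub>j\<close> forces \<open>\<lambda>\<^sub>j \<ge> 1\<close>.\<close>

definition symmetric_strongly_shifted :: "nat \<Rightarrow> 'k::field mpoly set \<Rightarrow> bool" where
  "symmetric_strongly_shifted n I \<longleftrightarrow>
     symmetric_monomial_ideal n I \<and>
     (\<forall>m \<in> partitions_of_ideal n I. \<forall>i j. 1 \<le> i \<longrightarrow> i < j \<longrightarrow> j \<le> n \<longrightarrow>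
        Poly_Mapping.lookup m i < Poly_Mapping.lookup m j \<longrightarrow>
        monom_of (m + Poly_Mapping.single i 1 - Poly_Mapping.single j 1) \<in> I)"

definition radical :: "('a, 'b) ring_scheme \<Rightarrow> 'a set \<Rightarrow> 'a set" where
  "radical R I = {a \<in> carrier R. \<exists>k::nat. k \<ge> 1 \<and> a [^]\<^bsub>R\<^esub> k \<in> I}"

text \<open>The height of a prime \<open>Q\<close> is the supremum of the lengths \<open>l\<close> of chains
  \<open>P\<^sub>0 \<subset> \<dots> \<subset> P\<^sub>l = Q\<close> of primes; the height of an ideal is the infimum of the heights of the
  primes containing it.\<close>

definition prime_height :: "('a, 'b) ring_scheme \<Rightarrow> 'a set \<Rightarrow> enat" where
  "prime_height R Q = Sup {enat l | l. \<exists>P :: nat \<Rightarrow> 'a set.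
     (\<forall>i \<le> l. primeideal (P i) R) \<and> (\<forall>i < l. P i \<subset> P (Suc i)) \<and> P l = Q}"

definition height :: "('a, 'b) ring_scheme \<Rightarrow> 'a set \<Rightarrow> enat" where
  "height R I = Inf {prime_height R Q | Q. primeideal Q R \<and> I \<subseteq> Q}"

text \<open>The ideal \<open>I\<^bsub>n,c\<^esub>\<close>; the sequences \<open>1 \<le> i\<^sub>1 < \<dots> < i\<^sub>c \<le> n\<close> are represented by the
  \<open>c\<close>-element subsets of \<open>{1..n}\<close>. Intersecting with the carrier makes the empty intersection
  (\<open>c > n\<close>) the unit ideal of the ring rather than the whole type.\<close>

definition sqfree_veronese :: "nat \<Rightarrow> nat \<Rightarrow> 'k::field mpoly set" where
  "sqfree_veronese n c = carrier (mpoly_ring n) \<inter>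
     (\<Inter>S \<in> {S. S \<subseteq> {1..n} \<and> card S = c}. Idl\<^bsub>mpoly_ring n\<^esub> (var ` S))"

lemma inj_map_key:
  assumes "bij \<sigma>"
  shows "inj (Poly_Mapping.map_key \<sigma> :: (nat \<Rightarrow>\<^sub>0 nat) \<Rightarrow> _)"
proof (rule injI)
  fix a b :: "nat \<Rightarrow>\<^sub>0 nat"
  assume *: "Poly_Mapping.map_key \<sigma> a = Poly_Mapping.map_key \<sigma> b"
  have "inj \<sigma>" "surj \<sigma>"
    using assms by (auto simp: bij_def)
  show "a = b"
  proof (rule poly_mapping_eqI)
    fix i
    obtain k where "i = \<sigma> k"
      using \<open>surj \<sigma>\<close> by (rule surjE)
    then show "Poly_Mapping.lookup a i = Poly_Mapping.lookup b i"
      using arg_cong[OF *, of "\<lambda>p. Poly_Mapping.lookup p k"]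
      by (simp add: map_key.rep_eq[OF \<open>inj \<sigma>\<close>])
  qed
qed

lemma perm_act_single:
  assumes "\<sigma> permutes A"
  shows "perm_act \<sigma> (Poly_Mapping.single (Poly_Mapping.map_key \<sigma> m) a) = Poly_Mapping.single m a"
  unfolding perm_act_def by (rule map_key_single[OF inj_map_key[OF permutes_bij[OF assms]]])

lemma perm_act_var:
  assumes "\<sigma> permutes A"
  shows "perm_act \<sigma> (var i) = var (\<sigma> i)"
  using perm_act_single[OF assms, of "Poly_Mapping.single (\<sigma> i) 1" 1]
    map_key_single[OF permutes_inj[OF assms], of i "1::nat"]
  by (simp add: var_def monom_of_def)

lemma cring_mpoly_ring: "cring (mpoly_ring n :: 'k::field mpoly ring)"
proof -
  have mem: "x \<in> carrier (mpoly_ring n) \<longleftrightarrow>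
      (\<forall>m \<in> Poly_Mapping.keys x. Poly_Mapping.keys m \<subseteq> {1..n})" for x :: "'k mpoly"
    by (simp add: mpoly_ring_def)
  have mult: "x * y \<in> carrier (mpoly_ring n)"
    if "x \<in> carrier (mpoly_ring n)" "y \<in> carrier (mpoly_ring n)" for x y :: "'k mpoly"
    unfolding mem
  proof
    fix m
    assume "m \<in> Poly_Mapping.keys (x * y)"
    then obtain a b where ab: "a \<in> Poly_Mapping.keys x" "b \<in> Poly_Mapping.keys y" "m = a + b"
      using keys_mult[of x y] by blast
    have "Poly_Mapping.keys a \<subseteq> {1..n}" "Poly_Mapping.keys b \<subseteq> {1..n}"
      using that ab unfolding mem by blast+
    then show "Poly_Mapping.keys m \<subseteq> {1..n}"
      unfolding \<open>m = a + b\<close> using Poly_Mapping.keys_add[of a b] by blast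
  qed
  have add: "x + y \<in> carrier (mpoly_ring n)"
    if "x \<in> carrier (mpoly_ring n)" "y \<in> carrier (mpoly_ring n)" for x y :: "'k mpoly"
    using that Poly_Mapping.keys_add[of x y] unfolding mem by blast
  have neg: "- x \<in> carrier (mpoly_ring n)" if "x \<in> carrier (mpoly_ring n)" for x :: "'k mpoly"
    using that unfolding mem by simp
  have zero: "(0 :: 'k mpoly) \<in> carrier (mpoly_ring n)" and one: "(1 :: 'k mpoly) \<in> carrier (mpoly_ring n)"
    unfolding mem by simp_all
  have ops: "x \<oplus>\<^bsub>mpoly_ring n\<^esub> y = x + y" "x \<otimes>\<^bsub>mpoly_ring n\<^esub> y = x * y"
    "\<zero>\<^bsub>mpoly_ring n\<^esub> = (0 :: 'k mpoly)" "\<one>\<^bsub>mpoly_ring n\<^esub> = (1 :: 'k mpoly)" for x y :: "'k mpoly"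
    by (simp_all add: mpoly_ring_def)
  show ?thesis
  proof (rule cringI)
    show "abelian_group (mpoly_ring n :: 'k mpoly ring)"
    proof (rule abelian_groupI; unfold ops)
      fix x :: "'k mpoly"
      assume "x \<in> carrier (mpoly_ring n)"
      then show "\<exists>y\<in>carrier (mpoly_ring n). y + x = 0"
        using neg by (intro bexI[of _ "- x"]) simp_all
    qed (simp_all add: add zero add_ac)
    show "Group.comm_monoid (mpoly_ring n :: 'k mpoly ring)"
      by (rule comm_monoidI; unfold ops) (simp_all add: mult one mult_ac)
  qed (simp add: ops distrib_right)
qed

end

theory Submission
  imports Defs
begin

text \<open>Let \<open>s\<close> be the smallest support size of a monomial in \<open>I\<close>. By symmetry every \<open>s\<close>-element set of
  variables is the support of a monomial in \<open>I\<close>, so \<open>\<surd>I\<close> is spanned by the monomials with support of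
  size at least \<open>s\<close>, which are exactly those meeting every set of \<open>c = n - s + 1\<close> variables. A prime
  containing \<open>I\<close> contains at least \<open>c\<close> variables, hence has height at least \<open>c\<close>.

  That \<open>(x\<^sub>i : i \<in> T)\<close> has height at most \<open>|T|\<close> follows from a count that avoids dimension theory.
  Given a chain \<open>P\<^sub>0 \<subset> \<dots> \<subset> P\<^sub>l = (x\<^sub>i : i \<in> T)\<close> of primes and \<open>a\<^sub>i \<in> P\<^bsub>i+1\<^esub> - P\<^sub>i\<close>, the products of a
  monomial in the variables outside \<open>T\<close> with powers of the \<open>a\<^sub>i\<close>, all exponents being at most \<open>D\<close>, are
  linearly independent. There are \<open>(D+1)\<^bsup>n-|T|+l\<^esup>\<close> of them, and their exponents are bounded by \<open>D E\<close>
  with \<open>E\<close> independent of \<open>D\<close>, so \<open>(D+1)\<^bsup>n-|T|+l\<^esup> \<le> (D E+1)\<^sup>n\<close> for all \<open>D\<close>, whence \<open>l \<le> |T|\<close>.\<close>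

section \<open>Polynomials spanned by a set of monomials\<close>

text \<open>The carrier, the monomial ideals and the spaces of bounded exponents all take this form,
  so membership is tested one exponent vector at a time. The restriction on the variables is left to
  \<open>U\<close>.\<close>

definition monomial_span :: "(nat \<Rightarrow>\<^sub>0 nat) set \<Rightarrow> 'k::field mpoly set" where
  "monomial_span U = {p. Poly_Mapping.keys p \<subseteq> U}"

lemma monomial_span_0 [simp]: "0 \<in> monomial_span U"
  by (simp add: monomial_span_def)

lemma monomial_span_add: "p \<in> monomial_span U \<Longrightarrow> q \<in> monomial_span U \<Longrightarrow> p + q \<in> monomial_span U"
  using Poly_Mapping.keys_add[of p q] by (auto simp: monomial_span_def)

lemma monomial_span_mult:
  assumes "p \<in> monomial_span U" "q \<in> monomial_span V"
    and "\<And>u v. u \<in> U \<Longrightarrow> v \<in> V \<Longrightarrow> u + v \<in> W"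
  shows "p * q \<in> monomial_span W"
  using assms keys_mult[of p q] unfolding monomial_span_def by blast

lemma monom_of_in_monomial_span [simp]: "monom_of m \<in> monomial_span U \<longleftrightarrow> m \<in> U"
  by (simp add: monomial_span_def monom_of_def)

lemma monom_of_0 [simp]: "monom_of 0 = 1"
  by (simp add: monom_of_def)

lemma monom_of_add: "monom_of (u + v) = monom_of u * monom_of v"
  by (simp add: monom_of_def mult_single)

lemma single_eq_mult_monom_of: "Poly_Mapping.single m c = Poly_Mapping.single 0 c * monom_of m"
  by (simp add: monom_of_def mult_single)

lemma monom_of_power: "monom_of m ^ k = monom_of (\<Sum>i<k. m)"
  by (induction k) (simp_all add: monom_of_add mult_ac del: sum_constant)

lemma var_power: "var i ^ k = monom_of (Poly_Mapping.single i k)"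
  by (induction k) (simp_all add: var_def monom_of_add[symmetric] single_add[symmetric])

lemma keys_add_nat: "Poly_Mapping.keys (u + v :: nat \<Rightarrow>\<^sub>0 nat) = Poly_Mapping.keys u \<union> Poly_Mapping.keys v"
  by (auto simp: in_keys_iff lookup_add)

lemma poly_mapping_eq_sum_single:
  "p = (\<Sum>m\<in>Poly_Mapping.keys p. Poly_Mapping.single m (Poly_Mapping.lookup p m))"
proof (rule poly_mapping_eqI)
  fix m
  show "Poly_Mapping.lookup p m =
      Poly_Mapping.lookup (\<Sum>m\<in>Poly_Mapping.keys p. Poly_Mapping.single m (Poly_Mapping.lookup p m)) m"
    by (cases "m \<in> Poly_Mapping.keys p")
      (auto simp: lookup_sum lookup_single when_def in_keys_iff)
qed

section \<open>Ideals of the polynomial ring\<close>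

lemma mpoly_ring_simps [simp]:
  "x \<otimes>\<^bsub>mpoly_ring n\<^esub> y = x * y" "x \<oplus>\<^bsub>mpoly_ring n\<^esub> y = x + y"
  "\<one>\<^bsub>mpoly_ring n\<^esub> = 1" "\<zero>\<^bsub>mpoly_ring n\<^esub> = 0"
  by (simp_all add: mpoly_ring_def)

lemma carrier_mpoly_ring: "carrier (mpoly_ring n) = monomial_span {m. Poly_Mapping.keys m \<subseteq> {1..n}}"
  by (auto simp: mpoly_ring_def monomial_span_def)

lemma mpoly_ring_pow [simp]: "x [^]\<^bsub>mpoly_ring n\<^esub> (k::nat) = x ^ k"
  by (induction k) (simp_all add: nat_pow_def mult.commute)

lemma ring_mpoly_ring: "ring (mpoly_ring n :: 'k::field mpoly ring)"
  using cring_mpoly_ring by (rule cring.axioms)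

lemma constant_in_carrier [simp]: "Poly_Mapping.single 0 c \<in> carrier (mpoly_ring n)"
  by (simp add: carrier_mpoly_ring monomial_span_def)

lemma carrier_mpoly_ring_mult:
  "x \<in> carrier (mpoly_ring n) \<Longrightarrow> y \<in> carrier (mpoly_ring n) \<Longrightarrow> x * y \<in> carrier (mpoly_ring n)"
  unfolding carrier_mpoly_ring by (erule (1) monomial_span_mult) (simp add: keys_add_nat)

lemma carrier_mpoly_ring_power:
  assumes "x \<in> carrier (mpoly_ring n)"
  shows "x ^ k \<in> carrier (mpoly_ring n)"
proof (induction k)
  case 0
  show ?case using constant_in_carrier[of 1] by simp
next
  case (Suc k)
  with assms show ?case by (simp add: carrier_mpoly_ring_mult)
qed

text \<open>Additive inverses come from multiplication by the constant -1, which lies in the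
  carrier.\<close>

lemma mpoly_idealI:
  assumes "J \<subseteq> carrier (mpoly_ring n)" "0 \<in> J"
    and add: "\<And>a b. a \<in> J \<Longrightarrow> b \<in> J \<Longrightarrow> a + b \<in> J"
    and mult: "\<And>x a. x \<in> carrier (mpoly_ring n) \<Longrightarrow> a \<in> J \<Longrightarrow> x * a \<in> J"
  shows "ideal J (mpoly_ring n :: 'k::field mpoly ring)"
proof (rule idealI[OF ring_mpoly_ring])
  interpret R: ring "mpoly_ring n :: 'k mpoly ring" by (rule ring_mpoly_ring)
  have neg: "- a \<in> J" if "a \<in> J" for a
    using mult[OF constant_in_carrier that, of "-1"] by (simp add: single_uminus)
  show "subgroup J (add_monoid (mpoly_ring n :: 'k mpoly ring))"
  proof (rule R.add.subgroupI)
    show "\<ominus>\<^bsub>mpoly_ring n\<^esub> a \<in> J" if "a \<in> J" for a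
    proof -
      have "a \<in> carrier (mpoly_ring n)" "- a \<in> carrier (mpoly_ring n)"
        using that neg assms(1) by auto
      then have "\<ominus>\<^bsub>mpoly_ring n\<^esub> a = - a"
        using R.minus_equality[of "- a" a] by simp
      then show ?thesis using neg[OF that] by simp
    qed
  qed (use assms in auto)
  show "x \<otimes>\<^bsub>mpoly_ring n\<^esub> a \<in> J" "a \<otimes>\<^bsub>mpoly_ring n\<^esub> x \<in> J"
    if "a \<in> J" "x \<in> carrier (mpoly_ring n)" for a x
    using mult[OF that(2,1)] by (simp_all add: mult.commute[of a x])
qed

context
  fixes n :: nat and J :: "'k::field mpoly set"
  assumes J: "ideal J (mpoly_ring n)"
begin

lemma mpoly_ideal_carrier: "a \<in> J \<Longrightarrow> a \<in> carrier (mpoly_ring n)"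
  using additive_subgroup.a_Hcarr[OF ideal.axioms(1)[OF J]] by simp

lemma mpoly_ideal_0: "0 \<in> J"
  using additive_subgroup.zero_closed[OF ideal.axioms(1)[OF J]] by simp

lemma mpoly_ideal_add: "a \<in> J \<Longrightarrow> b \<in> J \<Longrightarrow> a + b \<in> J"
  using additive_subgroup.a_closed[OF ideal.axioms(1)[OF J]] by simp

lemma mpoly_ideal_mult: "x \<in> carrier (mpoly_ring n) \<Longrightarrow> a \<in> J \<Longrightarrow> x * a \<in> J"
  using ideal.I_l_closed[OF J] by simp

lemma mpoly_ideal_diff: "a \<in> J \<Longrightarrow> b \<in> J \<Longrightarrow> a - b \<in> J"
  using mpoly_ideal_add[of a "- b"] mpoly_ideal_mult[OF constant_in_carrier, of b "-1"]
  by (simp add: single_uminus)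

lemma mpoly_ideal_sum: "(\<And>i. i \<in> A \<Longrightarrow> f i \<in> J) \<Longrightarrow> sum f A \<in> J"
  by (induction A rule: infinite_finite_induct) (auto intro: mpoly_ideal_add mpoly_ideal_0)

text \<open>A polynomial is the sum of its terms, and each term is a constant of the carrier times a
  monomial.\<close>

lemma monomial_span_subset_ideal:
  assumes "\<And>m. m \<in> U \<Longrightarrow> monom_of m \<in> J"
  shows "monomial_span U \<subseteq> J"
proof
  fix p :: "'k mpoly"
  assume "p \<in> monomial_span U"
  then have "Poly_Mapping.single m (Poly_Mapping.lookup p m) \<in> J" if "m \<in> Poly_Mapping.keys p" for m
    unfolding single_eq_mult_monom_of[of m] using that assms
    by (intro mpoly_ideal_mult) (auto simp: monomial_span_def)
  then show "p \<in> J"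
    by (subst poly_mapping_eq_sum_single) (rule mpoly_ideal_sum)
qed

end

lemma ideal_monomial_span:
  assumes "\<And>u. u \<in> U \<Longrightarrow> Poly_Mapping.keys u \<subseteq> {1..n}"
    and "\<And>u v. u \<in> U \<Longrightarrow> Poly_Mapping.keys v \<subseteq> {1..n} \<Longrightarrow> v + u \<in> U"
  shows "ideal (monomial_span U) (mpoly_ring n)"
proof (rule mpoly_idealI)
  show "x * a \<in> monomial_span U" if "x \<in> carrier (mpoly_ring n)" "a \<in> monomial_span U" for x a
    using that(1)[unfolded carrier_mpoly_ring] that(2)
    by (rule monomial_span_mult) (simp add: assms)
  show "monomial_span U \<subseteq> carrier (mpoly_ring n)"
    using assms(1) by (auto simp: carrier_mpoly_ring monomial_span_def)
qed (simp_all add: monomial_span_add)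

text \<open>The exponents on the right are the multiples of the generators. Their span is an ideal
  containing the generators; conversely, each of these monomials is a carrier element times a
  generator.\<close>

lemma Idl_monom_of:
  assumes "\<And>m. m \<in> M \<Longrightarrow> Poly_Mapping.keys m \<subseteq> {1..n}"
  shows "Idl\<^bsub>mpoly_ring n\<^esub> (monom_of ` M) =
    monomial_span {u + v | u v. u \<in> M \<and> Poly_Mapping.keys v \<subseteq> {1..n}}" (is "?I = monomial_span ?U")
proof
  have "ideal (monomial_span ?U) (mpoly_ring n)"
  proof (rule ideal_monomial_span)
    fix w v assume "w \<in> ?U" "Poly_Mapping.keys (v :: nat \<Rightarrow>\<^sub>0 nat) \<subseteq> {1..n}"
    then obtain u u' where "w = u + u'" "u \<in> M" "Poly_Mapping.keys u' \<subseteq> {1..n}" by blast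
    then show "v + w \<in> ?U"
      using \<open>Poly_Mapping.keys v \<subseteq> _\<close>
      by (intro CollectI exI[of _ u] exI[of _ "u' + v"]) (auto simp: add_ac keys_add_nat)
  next
    fix w assume "w \<in> ?U"
    then show "Poly_Mapping.keys w \<subseteq> {1..n}"
      using assms by (force simp: keys_add_nat simp del: atLeastAtMost_iff)
  qed
  moreover have "m \<in> ?U" if "m \<in> M" for m
    using that by (intro CollectI exI[of _ m] exI[of _ 0]) auto
  ultimately show "?I \<subseteq> monomial_span ?U"
    by (intro ring.genideal_minimal[OF ring_mpoly_ring]) auto
next
  have M: "monom_of ` M \<subseteq> carrier (mpoly_ring n)"
    using assms by (auto simp: carrier_mpoly_ring)
  have "ideal ?I (mpoly_ring n)" "monom_of ` M \<subseteq> ?I"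
    using ring.genideal_ideal[OF ring_mpoly_ring M] ring.genideal_self[OF ring_mpoly_ring M] .
  then show "monomial_span ?U \<subseteq> ?I"
  proof (intro monomial_span_subset_ideal)
    fix m assume "m \<in> ?U"
    then obtain u v where "m = v + u" "u \<in> M" "Poly_Mapping.keys v \<subseteq> {1..n}"
      by (auto simp: add.commute)
    then show "monom_of m \<in> ?I"
      unfolding \<open>m = _\<close> monom_of_add
      using \<open>monom_of ` M \<subseteq> ?I\<close> \<open>ideal ?I _\<close>
      by (intro mpoly_ideal_mult) (auto simp: carrier_mpoly_ring)
  qed
qed

section \<open>Monomial primes\<close>

text \<open>For \<open>S\<close> inside \<open>{1..n}\<close> this is the ideal generated by the
  variables in \<open>S\<close>, see \<open>Idl_var\<close>; for \<open>S = {}\<close> it is the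
  zero ideal.\<close>

definition var_ideal :: "nat \<Rightarrow> nat set \<Rightarrow> 'k::field mpoly set" where
  "var_ideal n S = monomial_span {m. Poly_Mapping.keys m \<subseteq> {1..n} \<and> Poly_Mapping.keys m \<inter> S \<noteq> {}}"

lemma Idl_var:
  assumes "S \<subseteq> {1..n}"
  shows "Idl\<^bsub>mpoly_ring n\<^esub> (var ` S) = var_ideal n S"
proof -
  let ?M = "(\<lambda>i. Poly_Mapping.single i (1::nat)) ` S"
  have "Poly_Mapping.keys m \<subseteq> {1..n}" if "m \<in> ?M" for m
    using assms that by auto
  then have "Idl\<^bsub>mpoly_ring n\<^esub> (monom_of ` ?M) =
      monomial_span {u + v | u v. u \<in> ?M \<and> Poly_Mapping.keys v \<subseteq> {1..n}}"
    by (rule Idl_monom_of)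
  moreover have "{u + v | u v. u \<in> ?M \<and> Poly_Mapping.keys v \<subseteq> {1..n}} =
      {m. Poly_Mapping.keys m \<subseteq> {1..n} \<and> Poly_Mapping.keys m \<inter> S \<noteq> {}}" (is "?A = ?B")
  proof
    show "?A \<subseteq> ?B" using assms by (force simp: keys_add_nat simp del: atLeastAtMost_iff)
    show "?B \<subseteq> ?A"
    proof
      fix m assume "m \<in> ?B"
      then obtain i where i: "i \<in> S" "i \<in> Poly_Mapping.keys m" "Poly_Mapping.keys m \<subseteq> {1..n}" by blast
      \<comment> \<open>The truncated subtraction is exact, because \<open>i\<close> in the support
        of \<open>m\<close> means an exponent of at least 1.\<close>
      have "m = Poly_Mapping.single i 1 + (m - Poly_Mapping.single i 1)"
        using i by (auto intro!: poly_mapping_eqI simp: lookup_add lookup_minus lookup_single when_def in_keys_iff)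
      moreover have "Poly_Mapping.keys (m - Poly_Mapping.single i 1) \<subseteq> {1..n}"
        using i by (auto simp: in_keys_iff lookup_minus)
      ultimately show "m \<in> ?A" using i by blast
    qed
  qed
  ultimately show ?thesis
    by (simp add: var_ideal_def image_image var_def)
qed

lemma ideal_var_ideal: "ideal (var_ideal n S) (mpoly_ring n)"
  unfolding var_ideal_def by (rule ideal_monomial_span) (auto simp: keys_add_nat)

text \<open>Modulo the variables in \<open>S\<close> only the part of a polynomial free of them
  survives, and polynomials over a field have no zero divisors.\<close>

lemma primeideal_var_ideal: "primeideal (var_ideal n S) (mpoly_ring n :: 'k::field mpoly ring)"
proof (rule primeidealI[OF ideal_var_ideal cring_mpoly_ring])
  have "(1 :: 'k mpoly) \<in> carrier (mpoly_ring n)" using constant_in_carrier[of 1] by simp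
  moreover have "(1 :: 'k mpoly) \<notin> var_ideal n S" by (simp add: var_ideal_def monomial_span_def)
  ultimately show "carrier (mpoly_ring n :: 'k mpoly ring) \<noteq> var_ideal n S" by blast
next
  fix a b :: "'k mpoly"
  assume ab: "a \<in> carrier (mpoly_ring n)" "b \<in> carrier (mpoly_ring n)"
    and *: "a \<otimes>\<^bsub>mpoly_ring n\<^esub> b \<in> var_ideal n S"
  define N where "N = {m :: nat \<Rightarrow>\<^sub>0 nat. Poly_Mapping.keys m \<subseteq> {1..n} \<and> Poly_Mapping.keys m \<inter> S = {}}"
  have split: "\<exists>q r. p = q + r \<and> q \<in> monomial_span N \<and> r \<in> var_ideal n S"
    if "p \<in> carrier (mpoly_ring n)" for p :: "'k mpoly"
  proof -
    let ?t = "\<lambda>m. Poly_Mapping.single m (Poly_Mapping.lookup p m)"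
    let ?q = "sum ?t (Poly_Mapping.keys p \<inter> N)" and ?r = "sum ?t (Poly_Mapping.keys p - N)"
    have "p = ?q + ?r"
      by (subst poly_mapping_eq_sum_single) (simp add: sum.Int_Diff)
    moreover have "?q \<in> monomial_span N"
      using keys_sum[of ?t] by (fastforce simp: monomial_span_def)
    moreover have "?r \<in> var_ideal n S"
      using that by (intro mpoly_ideal_sum[OF ideal_var_ideal])
        (auto simp: var_ideal_def N_def carrier_mpoly_ring monomial_span_def)
    ultimately show ?thesis by blast
  qed
  obtain q r where a: "a = q + r" "q \<in> monomial_span N" "r \<in> var_ideal n S" using split[OF ab(1)] by blast
  obtain q' r' where b: "b = q' + r'" "q' \<in> monomial_span N" "r' \<in> var_ideal n S" using split[OF ab(2)] by blast
  have q: "q \<in> carrier (mpoly_ring n)"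
    using a(2) by (auto simp: carrier_mpoly_ring monomial_span_def N_def)
  \<comment> \<open>The product of the two \<open>S\<close>-free parts differs from
    \<open>a * b\<close> by an element of the ideal. It is thus both in the ideal and free of
    \<open>S\<close>, hence zero.\<close>
  have "q * q' = a * b - (b * r + q * r')"
    by (simp add: a b algebra_simps)
  also have "\<dots> \<in> var_ideal n S"
    using mpoly_ideal_mult[OF ideal_var_ideal ab(2) a(3)] mpoly_ideal_mult[OF ideal_var_ideal q b(3)] *
    by (intro mpoly_ideal_diff[OF ideal_var_ideal] mpoly_ideal_add[OF ideal_var_ideal])
      (simp_all add: mult.commute[of b r])
  finally have "q * q' \<in> var_ideal n S" .
  moreover have "q * q' \<in> monomial_span N"
    using a(2) b(2) by (rule monomial_span_mult) (auto simp: N_def keys_add_nat)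
  ultimately have "Poly_Mapping.keys (q * q') = {}"
    unfolding var_ideal_def monomial_span_def N_def by blast
  then have "q = 0 \<or> q' = 0" by simp
  then show "a \<in> var_ideal n S \<or> b \<in> var_ideal n S"
    using a b by auto
qed

section \<open>Prime ideals and the variables they contain\<close>

context
  fixes n :: nat and Q :: "'k::field mpoly set"
  assumes Q: "primeideal Q (mpoly_ring n)"
begin

lemma prime_is_ideal: "ideal Q (mpoly_ring n)"
  using Q by (rule primeideal.axioms)

lemma one_notin_prime: "1 \<notin> Q"
proof
  assume "1 \<in> Q"
  then have "x \<in> Q" if "x \<in> carrier (mpoly_ring n)" for x
    using mpoly_ideal_mult[OF prime_is_ideal that, of 1] by simp
  then show False
    using primeideal.I_notcarr[OF Q] mpoly_ideal_carrier[OF prime_is_ideal] by blast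
qed

lemma prime_multD:
  "a \<in> carrier (mpoly_ring n) \<Longrightarrow> b \<in> carrier (mpoly_ring n) \<Longrightarrow> a * b \<in> Q \<Longrightarrow> a \<in> Q \<or> b \<in> Q"
  using primeideal.I_prime[OF Q, of a b] by simp

lemma prime_powerD:
  assumes "a \<in> carrier (mpoly_ring n)" "a ^ k \<in> Q"
  shows "a \<in> Q"
  using assms(2)
proof (induction k)
  case 0
  then show ?case using one_notin_prime by simp
next
  case (Suc k)
  then show ?case
    using prime_multD[OF assms(1) carrier_mpoly_ring_power[OF assms(1)]] by auto
qed

text \<open>The monomial is a product of powers of variables, one for each index in the support; the
  induction splits off one power at a time.\<close>

lemma prime_monom_ofD:
  assumes "Poly_Mapping.keys m \<subseteq> {1..n}" "monom_of m \<in> Q"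
  shows "\<exists>i\<in>Poly_Mapping.keys m. var i \<in> Q"
proof -
  have "\<exists>i\<in>A. var i \<in> Q"
    if "finite A" "A \<subseteq> {1..n}" "monom_of (\<Sum>i\<in>A. Poly_Mapping.single i (f i)) \<in> Q"
    for A and f :: "nat \<Rightarrow> nat"
    using that
  proof (induction A)
    case empty
    then show ?case using one_notin_prime by simp
  next
    case (insert x A)
    have "var x ^ f x * monom_of (\<Sum>i\<in>A. Poly_Mapping.single i (f i)) \<in> Q"
      using insert by (simp add: monom_of_add var_power)
    moreover have "(var x :: 'k mpoly) \<in> carrier (mpoly_ring n)"
      using insert.prems by (simp add: var_def carrier_mpoly_ring)
    moreover have "(monom_of (\<Sum>i\<in>A. Poly_Mapping.single i (f i)) :: 'k mpoly) \<in> carrier (mpoly_ring n)"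
      using insert.prems insert.hyps(1)
      by (auto simp: carrier_mpoly_ring in_keys_iff lookup_sum lookup_single when_def subset_iff)
    ultimately have "var x \<in> Q \<or> monom_of (\<Sum>i\<in>A. Poly_Mapping.single i (f i)) \<in> Q"
      using prime_multD carrier_mpoly_ring_power prime_powerD by blast
    then show ?case using insert by auto
  qed
  from this[of "Poly_Mapping.keys m" "Poly_Mapping.lookup m"] assms show ?thesis
    by (simp flip: poly_mapping_eq_sum_single)
qed

end

section \<open>Lower bound for the height of a prime\<close>

lemma var_ideal_subset:
  assumes "ideal J (mpoly_ring n)" "\<And>i. i \<in> S \<Longrightarrow> var i \<in> J" "S \<subseteq> {1..n}"
  shows "var_ideal n S \<subseteq> J"
  unfolding Idl_var[OF assms(3), symmetric]
  using assms by (intro ring.genideal_minimal[OF ring_mpoly_ring]) auto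

text \<open>Adjoining the variables of \<open>S\<close> one at a time, starting from the zero ideal,
  gives a chain of primes below \<open>Q\<close>.\<close>

lemma prime_height_ge:
  fixes Q :: "'k::field mpoly set"
  assumes Q: "primeideal Q (mpoly_ring n)" and S: "S \<subseteq> {1..n}" "\<And>i. i \<in> S \<Longrightarrow> var i \<in> Q"
  shows "enat (card S) \<le> prime_height (mpoly_ring n) Q"
proof -
  have "finite S" using S(1) finite_subset by blast
  then obtain t where t: "bij_betw t {0..<card S} S"
    using ex_bij_betw_nat_finite by blast
  define c where "c = card S"
  \<comment> \<open>\<open>Q\<close> takes the place of the ideal of all variables in
    \<open>S\<close>, so that the chain ends in \<open>Q\<close> even if that ideal is smaller. The
    last inclusion stays proper because the last variable is in \<open>Q\<close> but not in the
    preceding ideal.\<close>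
  define P :: "nat \<Rightarrow> 'k mpoly set" where "P k = (if k < c then var_ideal n (t ` {0..<k}) else Q)" for k
  have tS: "t i \<in> S" if "i < c" for i
    using t that by (auto simp: c_def dest: bij_betwE)
  have sub: "var_ideal n (t ` {0..<k}) \<subseteq> Q" if "k \<le> c" for k
    using that tS S by (intro var_ideal_subset prime_is_ideal[OF Q]) fastforce+
  have "P i \<subset> P (Suc i)" if "i < c" for i
  proof -
    have "t i \<notin> t ` {0..<i}"
      using bij_betw_imp_inj_on[OF t] that by (fastforce simp: c_def inj_on_def)
    then have "var (t i) \<notin> P i"
      using that by (simp add: P_def var_ideal_def var_def)
    moreover have "var (t i) \<in> P (Suc i)"
      using that tS[OF that] S by (auto simp: P_def var_ideal_def var_def)
    moreover have "P i \<subseteq> P (Suc i)"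
    proof (cases "Suc i < c")
      case True
      then show ?thesis
        by (fastforce simp: P_def var_ideal_def monomial_span_def)
    next
      case False
      then show ?thesis using that sub[of i] by (simp add: P_def)
    qed
    ultimately show ?thesis by blast
  qed
  moreover have "primeideal (P i) (mpoly_ring n)" for i
    using Q by (simp add: P_def primeideal_var_ideal)
  moreover have "P c = Q" by (simp add: P_def)
  ultimately show ?thesis
    unfolding prime_height_def c_def[symmetric] by (intro Sup_upper) blast
qed

section \<open>The height of a monomial prime\<close>

text \<open>Bounding each exponent separately, rather than the total degree, makes the count an
  exact power, and the bounds add under multiplication.\<close>

definition exponent_box :: "nat set \<Rightarrow> nat \<Rightarrow> (nat \<Rightarrow>\<^sub>0 nat) set" where
  "exponent_box S D = {m. Poly_Mapping.keys m \<subseteq> S \<and> (\<forall>i. Poly_Mapping.lookup m i \<le> D)}"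

lemma card_exponent_box:
  assumes "finite S"
  shows "finite (exponent_box S D)" and "card (exponent_box S D) = (D + 1) ^ card S"
proof -
  define g where "g h = Abs_poly_mapping (\<lambda>i. if i \<in> S then h i else (0::nat))" for h
  have lookup_g: "Poly_Mapping.lookup (g h) i = (if i \<in> S then h i else 0)" for h i
    unfolding g_def using assms by (subst lookup_Abs_poly_mapping) (auto intro: rev_finite_subset)
  have "bij_betw (\<lambda>m. restrict (Poly_Mapping.lookup m) S) (exponent_box S D) (S \<rightarrow>\<^sub>E {..D})"
  proof (rule bij_betw_byWitness[where f' = g])
    show "\<forall>m\<in>exponent_box S D. g (restrict (Poly_Mapping.lookup m) S) = m"
      by (auto intro!: poly_mapping_eqI simp: lookup_g exponent_box_def in_keys_iff subset_iff)
    show "\<forall>h\<in>S \<rightarrow>\<^sub>E {..D}. restrict (Poly_Mapping.lookup (g h)) S = h"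
      by (auto simp: lookup_g restrict_def PiE_def extensional_def fun_eq_iff)
    show "g ` (S \<rightarrow>\<^sub>E {..D}) \<subseteq> exponent_box S D"
      by (auto simp: exponent_box_def in_keys_iff lookup_g PiE_iff split: if_splits)
  qed (auto simp: exponent_box_def)
  then show "finite (exponent_box S D)" and "card (exponent_box S D) = (D + 1) ^ card S"
    using assms by (auto simp: bij_betw_finite bij_betw_same_card card_PiE finite_PiE)
qed

lemma monomial_span_box_mult:
  assumes "p \<in> monomial_span (exponent_box S D)" "q \<in> monomial_span (exponent_box S E)"
  shows "p * q \<in> monomial_span (exponent_box S (D + E))"
  using assms by (rule monomial_span_mult) (auto simp: exponent_box_def keys_add_nat lookup_add add_mono)

lemma monomial_span_box_power:
  assumes "p \<in> monomial_span (exponent_box S D)"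
  shows "p ^ j \<in> monomial_span (exponent_box S (j * D))"
proof (induction j)
  case 0
  show ?case by (simp add: monomial_span_def exponent_box_def)
next
  case (Suc j)
  show ?case using monomial_span_box_mult[OF assms Suc] by simp
qed

lemma monomial_span_mono: "U \<subseteq> V \<Longrightarrow> monomial_span U \<subseteq> monomial_span V"
  by (auto simp: monomial_span_def)

lemma exponent_box_mono: "S \<subseteq> T \<Longrightarrow> D \<le> E \<Longrightarrow> exponent_box S D \<subseteq> exponent_box T E"
  by (auto simp: exponent_box_def intro: order_trans)

lemma carrier_in_box:
  assumes "p \<in> carrier (mpoly_ring n)"
  shows "\<exists>E. p \<in> monomial_span (exponent_box {1..n} E)"
proof -
  \<comment> \<open>A crude common bound: the sum of all exponents of all monomials of
    \<open>p\<close> dominates each of them.\<close>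
  define E where "E = (\<Sum>m\<in>Poly_Mapping.keys p. \<Sum>i\<in>Poly_Mapping.keys m. Poly_Mapping.lookup m i)"
  have "Poly_Mapping.lookup m i \<le> E" if "m \<in> Poly_Mapping.keys p" for m i
  proof (cases "i \<in> Poly_Mapping.keys m")
    case True
    then have "Poly_Mapping.lookup m i \<le> (\<Sum>i\<in>Poly_Mapping.keys m. Poly_Mapping.lookup m i)"
      by (intro member_le_sum) auto
    also have "\<dots> \<le> E" unfolding E_def using that
      by (intro member_le_sum[of m _ "\<lambda>m. \<Sum>i\<in>Poly_Mapping.keys m. Poly_Mapping.lookup m i"]) auto
    finally show ?thesis .
  qed (simp add: in_keys_iff)
  then show ?thesis using assms
    by (intro exI[of _ E]) (auto simp: carrier_mpoly_ring monomial_span_def exponent_box_def)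
qed

section \<open>Linear independence over \<open>'k\<close> modulo an ideal\<close>

definition independent_mod :: "'k::field mpoly set \<Rightarrow> 'i set \<Rightarrow> ('i \<Rightarrow> 'k mpoly) \<Rightarrow> bool" where
  "independent_mod J A f \<longleftrightarrow>
     (\<forall>c. (\<Sum>i\<in>A. Poly_Mapping.single 0 (c i) * f i) \<in> J \<longrightarrow> (\<forall>i\<in>A. c i = 0))"

text \<open>Two equal members, taken with coefficients 1 and -1, would give a nontrivial relation
  with value 0.\<close>

lemma independent_mod_inj_on:
  assumes "independent_mod J A f" "0 \<in> J" "finite A"
  shows "inj_on f A"
proof (rule inj_onI, rule ccontr)
  fix x y assume xy: "x \<in> A" "y \<in> A" "f x = f y" "x \<noteq> y"
  define c where "c i = (if i = x then 1 else if i = y then -1 else 0 :: 'a)" for i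
  have "(\<Sum>i\<in>A. Poly_Mapping.single 0 (c i) * f i) = (\<Sum>i\<in>{x, y}. Poly_Mapping.single 0 (c i) * f i)"
    using xy assms(3) by (intro sum.mono_neutral_right) (auto simp: c_def)
  also have "\<dots> = 0" using xy by (simp add: c_def single_uminus)
  finally have "c x = 0" using assms xy unfolding independent_mod_def by metis
  then show False by (simp add: c_def)
qed

text \<open>Families suit products indexed by pairs, sets suit the comparison of dimensions; this
  passes from one to the other without losing cardinality.\<close>

lemma independent_mod_image:
  assumes "independent_mod J A f" "0 \<in> J" "finite A"
  shows "independent_mod J (f ` A) (\<lambda>x. x)" and "card (f ` A) = card A"
proof -
  note inj = independent_mod_inj_on[OF assms]
  show "card (f ` A) = card A" using inj by (rule card_image)
  show "independent_mod J (f ` A) (\<lambda>x. x)"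
    unfolding independent_mod_def sum.reindex[OF inj]
  proof (intro allI impI)
    fix c assume "(sum ((\<lambda>i. Poly_Mapping.single 0 (c i) * i) \<circ> f) A) \<in> J"
    then have "\<forall>i\<in>A. (c \<circ> f) i = 0"
      using assms(1) unfolding independent_mod_def by (auto simp: o_def)
    then show "\<forall>i\<in>f ` A. c i = 0" by simp
  qed
qed

lemma vector_space_mpoly: "vector_space (\<lambda>c p. Poly_Mapping.single 0 c * p :: 'k::field mpoly)"
  by unfold_locales (simp_all add: algebra_simps single_add mult_single flip: mult.assoc)

text \<open>As \<open>J\<close> contains 0, independence modulo \<open>J\<close> implies
  independence over \<open>'k\<close>, and \<open>B\<close> lies in a space spanned by at most
  \<open>card U\<close> monomials.\<close>

lemma independent_mod_card_le:
  fixes B :: "'k::field mpoly set"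
  assumes "independent_mod J B (\<lambda>x. x)" "0 \<in> J" "finite B" "B \<subseteq> monomial_span U" "finite U"
  shows "card B \<le> card U"
proof -
  interpret vector_space "\<lambda>c p. Poly_Mapping.single 0 c * p :: 'k mpoly" by (rule vector_space_mpoly)
  have "independent B"
  proof (rule independent_if_scalars_zero[OF assms(3)])
    fix c x assume "(\<Sum>x\<in>B. Poly_Mapping.single 0 (c x) * x) = 0" "x \<in> B"
    then show "c x = 0" using assms(1,2) unfolding independent_mod_def by auto
  qed
  moreover have "B \<subseteq> span (monom_of ` U)"
  proof
    fix p assume "p \<in> B"
    then have "Poly_Mapping.keys p \<subseteq> U" using assms(4) by (auto simp: monomial_span_def)
    then show "p \<in> span (monom_of ` U)"
      by (subst poly_mapping_eq_sum_single, subst single_eq_mult_monom_of)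
        (intro span_sum span_scale span_base, auto)
  qed
  ultimately have "card B \<le> card (monom_of ` U :: 'k mpoly set)"
    using assms(5) by (intro independent_span_bound[THEN conjunct2]) auto
  also have "\<dots> \<le> card U" using assms(5) by (rule card_image_le)
  finally show ?thesis .
qed

text \<open>The descent step along a chain of primes: each proper inclusion supplies an element
  \<open>a\<close> whose powers enlarge an independent family by the factor
  \<open>D + 1\<close>.\<close>

lemma independent_mod_powers:
  fixes P Q :: "'k::field mpoly set"
  assumes P: "primeideal P (mpoly_ring n)" and Q: "ideal Q (mpoly_ring n)" and "P \<subseteq> Q"
    and a: "a \<in> Q" "a \<notin> P"
    and f: "independent_mod Q A f" "\<And>i. i \<in> A \<Longrightarrow> f i \<in> carrier (mpoly_ring n)" and "finite A"
  shows "independent_mod P (A \<times> {..D::nat}) (\<lambda>(i, j). f i * a ^ j)"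
proof -
  define b where "b c = (\<Sum>i\<in>A. Poly_Mapping.single 0 (c i) * f i)" for c
  have acar: "a \<in> carrier (mpoly_ring n)" using mpoly_ideal_carrier[OF Q a(1)] .
  have car: "ideal (carrier (mpoly_ring n)) (mpoly_ring n :: 'k mpoly ring)"
    by (rule ring.oneideal[OF ring_mpoly_ring])
  have bcar: "b c \<in> carrier (mpoly_ring n)" for c
    unfolding b_def using f(2) by (intro mpoly_ideal_sum[OF car] carrier_mpoly_ring_mult) auto
  have sumcar: "(\<Sum>j\<le>D. b (c j) * a ^ j) \<in> carrier (mpoly_ring n)" for c and D :: nat
    using bcar acar by (intro mpoly_ideal_sum[OF car] carrier_mpoly_ring_mult carrier_mpoly_ring_power)
  have bQ: "c i = 0" if "b c \<in> Q" "i \<in> A" for c i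
    using f(1) that unfolding independent_mod_def b_def by blast
  \<comment> \<open>Modulo \<open>Q\<close> only the term \<open>j = 0\<close> survives, so it vanishes; then cancel \<open>a\<close> modulo \<open>P\<close>.\<close>
  have main: "c j i = 0" if "(\<Sum>j\<le>D. b (c j) * a ^ j) \<in> P" "j \<le> D" "i \<in> A" for D c j i
    using that
  proof (induction D arbitrary: c j)
    case 0
    then show ?case using bQ[of "c 0" i] \<open>P \<subseteq> Q\<close> by auto
  next
    case (Suc D)
    \<comment> \<open>Factoring \<open>a\<close> out of all terms but the first leaves a sum with
      shifted coefficients, to which the induction hypothesis applies; this is why \<open>c\<close>
      and \<open>j\<close> are arbitrary.\<close>
    let ?r = "\<Sum>j\<le>D. b (c (Suc j)) * a ^ j"
    have eq: "(\<Sum>j\<le>Suc D. b (c j) * a ^ j) = b (c 0) + ?r * a"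
      by (subst sum.atMost_Suc_shift) (simp add: sum_distrib_left mult_ac)
    have "b (c 0) = (\<Sum>j\<le>Suc D. b (c j) * a ^ j) - ?r * a"
      by (simp only: eq) simp
    also have "\<dots> \<in> Q"
      using Suc.prems(1) \<open>P \<subseteq> Q\<close> mpoly_ideal_mult[OF Q sumcar a(1)]
      by (intro mpoly_ideal_diff[OF Q]) auto
    finally have c0: "c 0 i = 0" if "i \<in> A" for i using bQ that by blast
    then have "b (c 0) = 0" by (simp add: b_def)
    then have "?r * a \<in> P" using Suc.prems(1) eq by simp
    then have "?r \<in> P" using prime_multD[OF P sumcar acar] a(2) by simp
    then show ?case
      using Suc.IH[of "\<lambda>j. c (Suc j)" "j - 1"] Suc.prems c0 by (cases j) auto
  qed
  show ?thesis
    unfolding independent_mod_def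
  proof (intro allI impI ballI)
    fix c x
    assume *: "(\<Sum>x\<in>A \<times> {..D}. Poly_Mapping.single 0 (c x) * (case x of (i, j) \<Rightarrow> f i * a ^ j)) \<in> P"
      and x: "x \<in> A \<times> {..D}"
    have "(\<Sum>x\<in>A \<times> {..D}. Poly_Mapping.single 0 (c x) * (case x of (i, j) \<Rightarrow> f i * a ^ j)) =
        (\<Sum>i\<in>A. \<Sum>j\<le>D. Poly_Mapping.single 0 (c (i, j)) * (f i * a ^ j))"
      by (subst sum.cartesian_product) (simp add: split_def)
    also have "\<dots> = (\<Sum>j\<le>D. b (\<lambda>i. c (i, j)) * a ^ j)"
      by (subst sum.swap) (simp add: b_def sum_distrib_right mult.assoc)
    finally show "c x = 0"
      using main[where D = D and c = "\<lambda>j i. c (i, j)" and j = "snd x" and i = "fst x"] * x by auto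
  qed
qed

text \<open>Distinct monomials cannot cancel: the coefficient of the combination at \<open>m\<close>
  is \<open>c m\<close>, and a nonzero one would force a variable of \<open>T\<close> into
  \<open>m\<close>. This starts the descent at the top of the chain.\<close>

lemma independent_mod_var_ideal:
  "finite A \<Longrightarrow> (\<And>m. m \<in> A \<Longrightarrow> Poly_Mapping.keys m \<inter> T = {}) \<Longrightarrow> independent_mod (var_ideal n T) A monom_of"
  unfolding independent_mod_def
proof (intro allI impI ballI, rule ccontr)
  fix c :: "_ \<Rightarrow> 'a" and m
  assume A: "finite A" "\<And>m. m \<in> A \<Longrightarrow> Poly_Mapping.keys m \<inter> T = {}" and m: "m \<in> A" "c m \<noteq> 0"
    and *: "(\<Sum>i\<in>A. Poly_Mapping.single 0 (c i) * monom_of i) \<in> var_ideal n T"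
  have "Poly_Mapping.lookup (\<Sum>i\<in>A. Poly_Mapping.single 0 (c i) * monom_of i) m = c m"
    using A m by (simp add: lookup_sum lookup_single when_def flip: single_eq_mult_monom_of)
  then have "Poly_Mapping.keys m \<inter> T \<noteq> {}"
    using * m(2) by (auto simp: var_ideal_def monomial_span_def in_keys_iff subset_iff)
  then show False using A(2) m(1) by blast
qed

text \<open>Descending \<open>k\<close> steps from the top of the chain multiplies the initial count
  by \<open>(D + 1) ^ k\<close>. It matters that \<open>E\<close> is chosen before \<open>D\<close>,
  since in the end \<open>D\<close> grows while \<open>E\<close> stays fixed.\<close>

lemma chain_independent:
  fixes P :: "nat \<Rightarrow> 'k::field mpoly set"
  assumes P: "\<And>i. i \<le> l \<Longrightarrow> primeideal (P i) (mpoly_ring n)" "\<And>i. i < l \<Longrightarrow> P i \<subset> P (Suc i)"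
    and Pl: "P l = var_ideal n T" and T: "T \<subseteq> {1..n}" and "k \<le> l"
  shows "\<exists>E. \<forall>D. \<exists>B. finite B \<and> card B = (D + 1) ^ (n - card T + k) \<and>
    B \<subseteq> monomial_span (exponent_box {1..n} (D * E)) \<and> independent_mod (P (l - k)) B (\<lambda>x. x)"
  using \<open>k \<le> l\<close>
proof (induction k)
  case 0
  have cardT: "card ({1..n} - T) = n - card T"
    using T by (simp add: card_Diff_subset finite_subset)
  show ?case
  \<comment> \<open>The starting set consists of the monomials in the variables outside
    \<open>T\<close> with exponents at most \<open>D\<close>, so \<open>E = 1\<close>
    serves.\<close>
  proof (intro exI[of _ 1] allI)
    fix D
    let ?A = "exponent_box ({1..n} - T) D"
    have fin: "finite ?A" and card: "card ?A = (D + 1) ^ (n - card T)"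
      using card_exponent_box[of "{1..n} - T" D] cardT by auto
    have ind: "independent_mod (P (l - 0)) ?A monom_of"
      unfolding diff_zero Pl by (rule independent_mod_var_ideal[OF fin]) (auto simp: exponent_box_def)
    have 0: "0 \<in> P (l - 0)" using P(1) prime_is_ideal mpoly_ideal_0 by (metis diff_zero order_refl)
    show "\<exists>B. finite B \<and> card B = (D + 1) ^ (n - card T + 0) \<and>
        B \<subseteq> monomial_span (exponent_box {1..n} (D * 1)) \<and> independent_mod (P (l - 0)) B (\<lambda>x. x)"
      using independent_mod_image[OF ind 0 fin] fin card
        exponent_box_mono[of "{1..n} - T" "{1..n}" D D]
      by (intro exI[of _ "monom_of ` ?A"]) auto
  qed
next
  case (Suc k)
  then obtain E where E: "\<And>D. \<exists>B. finite B \<and> card B = (D + 1) ^ (n - card T + k) \<and>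
    B \<subseteq> monomial_span (exponent_box {1..n} (D * E)) \<and> independent_mod (P (l - k)) B (\<lambda>x. x)"
    by auto
  define i where "i = l - Suc k"
  have i: "i < l" "l - k = Suc i" using Suc.prems by (auto simp: i_def)
  obtain a where a: "a \<in> P (Suc i)" "a \<notin> P i" using P(2)[OF i(1)] by blast
  have prime: "primeideal (P i) (mpoly_ring n)" "ideal (P (Suc i)) (mpoly_ring n)"
    using P(1)[of i] prime_is_ideal[OF P(1)[of "Suc i"]] i by auto
  obtain F where F: "a \<in> monomial_span (exponent_box {1..n} F)"
    using carrier_in_box[OF mpoly_ideal_carrier[OF prime(2) a(1)]] by blast
  show ?case
  \<comment> \<open>\<open>F\<close> bounds the exponents of \<open>a\<close>, so a factor
    \<open>a ^ j\<close> with \<open>j \<le> D\<close> raises the bound \<open>D * E\<close> by at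
    most \<open>D * F\<close>.\<close>
  proof (intro exI[of _ "E + F"] allI)
    fix D
    obtain B where B: "finite B" "card B = (D + 1) ^ (n - card T + k)"
      "B \<subseteq> monomial_span (exponent_box {1..n} (D * E))" "independent_mod (P (Suc i)) B (\<lambda>x. x)"
      using E[of D] i by auto
    let ?f = "\<lambda>(b, j). b * a ^ j"
    have Bcar: "b \<in> carrier (mpoly_ring n)" if "b \<in> B" for b
      using that B(3) by (fastforce simp: carrier_mpoly_ring monomial_span_def exponent_box_def)
    have ind: "independent_mod (P i) (B \<times> {..D}) ?f"
      using P(2)[OF i(1)] Bcar
      by (intro independent_mod_powers[OF prime _ a B(4) _ B(1)]) auto
    have fin: "finite (B \<times> {..D})" using B(1) by simp
    have "?f x \<in> monomial_span (exponent_box {1..n} (D * (E + F)))" if xB: "x \<in> B \<times> {..D}" for x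
    proof -
      obtain b j where x: "x = (b, j)" "b \<in> B" "j \<le> D" using xB by auto
      have "b * a ^ j \<in> monomial_span (exponent_box {1..n} (D * E + j * F))"
        using x(2) B(3) F by (intro monomial_span_box_mult monomial_span_box_power) auto
      moreover have "D * E + j * F \<le> D * (E + F)" using x(3) by (simp add: distrib_left)
      ultimately show ?thesis
        using x(1) monomial_span_mono[OF exponent_box_mono[OF order_refl]] by auto
    qed
    then have "?f ` (B \<times> {..D}) \<subseteq> monomial_span (exponent_box {1..n} (D * (E + F)))" by blast
    then show "\<exists>B. finite B \<and> card B = (D + 1) ^ (n - card T + Suc k) \<and>
        B \<subseteq> monomial_span (exponent_box {1..n} (D * (E + F))) \<and>
        independent_mod (P (l - Suc k)) B (\<lambda>x. x)"
      using independent_mod_image[OF ind mpoly_ideal_0[OF prime_is_ideal[OF prime(1)]] fin] fin B(2)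
      unfolding i_def[symmetric]
      by (intro exI[of _ "?f ` (B \<times> {..D})"]) (simp add: card_cartesian_product)
  qed
qed

text \<open>As functions of \<open>D\<close>, the left side has degree \<open>N\<close> and the
  right side degree at most \<open>n\<close>.\<close>

lemma power_growth:
  assumes "\<And>D::nat. (D + 1) ^ N \<le> (D * E + 1) ^ n"
  shows "N \<le> n"
proof (rule ccontr)
  assume "\<not> N \<le> n"
  \<comment> \<open>With this value, bounding \<open>D * E + 1\<close> by
    \<open>(E + 1) * (D + 1)\<close> turns the right side into \<open>D * (D + 1) ^ n\<close>, which
    is less than \<open>(D + 1) * (D + 1) ^ n\<close>.\<close>
  define D where "D = (E + 1) ^ n"
  have "(D + 1) * (D + 1) ^ n = (D + 1) ^ Suc n" by simp
  also have "\<dots> \<le> (D + 1) ^ N" using \<open>\<not> N \<le> n\<close> by (intro power_increasing) auto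
  also have "\<dots> \<le> (D * E + 1) ^ n" by (rule assms)
  also have "\<dots> \<le> ((E + 1) * (D + 1)) ^ n" by (intro power_mono) (auto simp: algebra_simps)
  also have "\<dots> = D * (D + 1) ^ n" by (simp only: power_mult_distrib D_def)
  finally show False by simp
qed

text \<open>Descending a whole chain of length \<open>l\<close> yields, for every \<open>D\<close>,
  linearly independent polynomials inside a box of \<open>(D * E + 1) ^ n\<close> monomials;
  comparing growth in \<open>D\<close> bounds \<open>l\<close>.\<close>

lemma prime_height_var_ideal_le:
  assumes "T \<subseteq> {1..n}"
  shows "prime_height (mpoly_ring n) (var_ideal n T :: 'k::field mpoly set) \<le> enat (card T)"
  unfolding prime_height_def
proof (rule Sup_least, clarify)
  fix l and P :: "nat \<Rightarrow> 'k mpoly set"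
  assume P: "\<forall>i\<le>l. primeideal (P i) (mpoly_ring n)" "\<forall>i<l. P i \<subset> P (Suc i)" "P l = var_ideal n T"
  obtain E where E: "\<And>D. \<exists>B. finite B \<and> card B = (D + 1) ^ (n - card T + l) \<and>
    B \<subseteq> monomial_span (exponent_box {1..n} (D * E)) \<and> independent_mod (P (l - l)) B (\<lambda>x. x)"
    using chain_independent[of l P n T l] P assms by auto
  have "(D + 1) ^ (n - card T + l) \<le> (D * E + 1) ^ n" for D
  proof -
    obtain B where B: "finite B" "card B = (D + 1) ^ (n - card T + l)"
      "B \<subseteq> monomial_span (exponent_box {1..n} (D * E))" "independent_mod (P 0) B (\<lambda>x. x)"
      using E[of D] by auto
    have "card B \<le> card (exponent_box {1..n} (D * E))"
      using P(1) by (intro independent_mod_card_le[OF B(4) mpoly_ideal_0[OF prime_is_ideal] B(1,3)]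
          card_exponent_box) auto
    then show ?thesis using B(2) card_exponent_box(2)[of "{1..n}" "D * E"] by simp
  qed
  then have "n - card T + l \<le> n" by (rule power_growth)
  \<comment> \<open>This makes the truncated difference \<open>n - card T\<close> exact.\<close>
  moreover have "card T \<le> n" using card_mono[OF _ assms] by simp
  ultimately show "enat l \<le> enat (card T)" by simp
qed

section \<open>The radical\<close>

lemma ideal_radical:
  assumes J: "ideal J (mpoly_ring n :: 'k::field mpoly ring)"
  shows "ideal (radical (mpoly_ring n) J) (mpoly_ring n)"
proof (rule mpoly_idealI)
  show "radical (mpoly_ring n) J \<subseteq> carrier (mpoly_ring n)"
    by (auto simp: radical_def)
  show "0 \<in> radical (mpoly_ring n) J"
    using mpoly_ideal_0[OF J] by (auto simp: radical_def carrier_mpoly_ring intro!: exI[of _ 1])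
  show "x * a \<in> radical (mpoly_ring n) J"
    if x: "x \<in> carrier (mpoly_ring n)" and "a \<in> radical (mpoly_ring n) J" for x a
  proof -
    obtain k where k: "k \<ge> 1" "a ^ k \<in> J" "a \<in> carrier (mpoly_ring n)"
      using \<open>a \<in> _\<close> by (auto simp: radical_def)
    have "(x * a) ^ k \<in> J"
      unfolding power_mult_distrib
      using k(2) by (intro mpoly_ideal_mult[OF J] carrier_mpoly_ring_power x)
    then show ?thesis
      using k carrier_mpoly_ring_mult[OF x k(3)] by (auto simp: radical_def)
  qed
  show "a + b \<in> radical (mpoly_ring n) J"
    if ab: "a \<in> radical (mpoly_ring n) J" "b \<in> radical (mpoly_ring n) J" for a b
  proof -
    obtain k l where k: "k \<ge> 1" "a ^ k \<in> J" "a \<in> carrier (mpoly_ring n)"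
      and l: "l \<ge> 1" "b ^ l \<in> J" "b \<in> carrier (mpoly_ring n)"
      using ab by (auto simp: radical_def)
    \<comment> \<open>In every term of the binomial expansion of exponent \<open>k + l\<close>,
      either \<open>a\<close> occurs to at least the power \<open>k\<close> or \<open>b\<close> to
      at least the power \<open>l\<close>.\<close>
    have "of_nat (k + l choose i) * a ^ i * b ^ (k + l - i) \<in> J" for i
    proof -
      have of_nat: "of_nat c \<in> carrier (mpoly_ring n :: 'k mpoly ring)" for c
        using constant_in_carrier[of "of_nat c"] by (simp only: single_of_nat)
      show ?thesis
      proof (cases "k \<le> i")
        case True
        have "of_nat (k + l choose i) * b ^ (k + l - i) * a ^ (i - k) * a ^ k \<in> J"
          by (intro mpoly_ideal_mult[OF J] carrier_mpoly_ring_mult carrier_mpoly_ring_power of_nat k l)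
        moreover have "a ^ i = a ^ (i - k) * a ^ k"
          using True by (metis le_add_diff_inverse2 power_add)
        ultimately show ?thesis by (simp only: mult_ac)
      next
        case False
        then have "k + l - i = (k - i) + l" by simp
        moreover have "of_nat (k + l choose i) * a ^ i * b ^ (k - i) * b ^ l \<in> J"
          by (intro mpoly_ideal_mult[OF J] carrier_mpoly_ring_mult carrier_mpoly_ring_power of_nat k l)
        ultimately show ?thesis by (simp only: power_add mult_ac)
      qed
    qed
    then have "(a + b) ^ (k + l) \<in> J"
      unfolding binomial_ring by (intro mpoly_ideal_sum[OF J])
    moreover have "a + b \<in> carrier (mpoly_ring n)"
      using k(3) l(3) by (simp add: carrier_mpoly_ring monomial_span_add)
    ultimately show ?thesis
      using k(1) by (auto simp: radical_def intro!: exI[of _ "k + l"])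
  qed
qed

lemma radical_subset_prime:
  assumes "primeideal Q (mpoly_ring n)" "J \<subseteq> Q"
  shows "radical (mpoly_ring n) J \<subseteq> Q"
  using prime_powerD[OF assms(1)] assms(2) by (auto simp: radical_def)

text \<open>Every variable of \<open>u\<close> occurs in \<open>m\<close>, so a high enough power of
  the monomial of \<open>m\<close> is divisible by that of \<open>u\<close>.\<close>

lemma monom_of_in_radical:
  assumes J: "ideal J (mpoly_ring n :: 'k::field mpoly ring)" and u: "monom_of u \<in> J"
    and m: "Poly_Mapping.keys u \<subseteq> Poly_Mapping.keys m" "Poly_Mapping.keys m \<subseteq> {1..n}"
  shows "monom_of m \<in> radical (mpoly_ring n) J"
proof -
  \<comment> \<open>The sum dominates each exponent of \<open>u\<close>; the successor ensures
    \<open>k \<ge> 1\<close>, as the radical requires, even for \<open>u = 0\<close>.\<close>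
  define k where "k = Suc (\<Sum>i\<in>Poly_Mapping.keys u. Poly_Mapping.lookup u i)"
  define w where "w = (\<Sum>i<k. m)"
  have w: "Poly_Mapping.lookup w i = k * Poly_Mapping.lookup m i" for i
    by (simp add: w_def lookup_sum del: sum_constant) simp
  have "Poly_Mapping.lookup u i \<le> Poly_Mapping.lookup w i" for i
  proof (cases "i \<in> Poly_Mapping.keys u")
    case True
    then have "Poly_Mapping.lookup u i \<le> (\<Sum>i\<in>Poly_Mapping.keys u. Poly_Mapping.lookup u i)"
      by (intro member_le_sum) auto
    also have "\<dots> \<le> k" by (simp add: k_def)
    also have "\<dots> \<le> Poly_Mapping.lookup w i"
    proof -
      have "i \<in> Poly_Mapping.keys m" using m(1) True by (rule subsetD)
      then show ?thesis by (simp add: w in_keys_iff)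
    qed
    finally show ?thesis .
  qed (simp add: in_keys_iff)
  \<comment> \<open>The pointwise inequality makes the truncated subtraction exact.\<close>
  then have w_eq: "w = (w - u) + u"
    by (intro poly_mapping_eqI) (simp add: lookup_add lookup_minus)
  have "Poly_Mapping.keys (w - u) \<subseteq> Poly_Mapping.keys m"
    by (auto simp: in_keys_iff lookup_minus w intro!: gr0I)
  with m(2) have "(monom_of (w - u) :: 'k mpoly) \<in> carrier (mpoly_ring n)"
    by (simp add: carrier_mpoly_ring)
  then have "monom_of w \<in> J"
    by (subst w_eq, subst monom_of_add) (rule mpoly_ideal_mult[OF J _ u])
  then have "monom_of m ^ k \<in> J"
    by (simp only: monom_of_power w_def)
  moreover have "k \<ge> 1" by (simp add: k_def)
  ultimately show ?thesis
    using m(2) by (auto simp: radical_def carrier_mpoly_ring)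
qed

section \<open>Monomials of large support\<close>

text \<open>These turn out to be the exponents in the radical: it depends only on the supports of
  the monomials in the ideal, and symmetry leaves only the size of a support.\<close>

definition large_support :: "nat \<Rightarrow> nat \<Rightarrow> (nat \<Rightarrow>\<^sub>0 nat) set" where
  "large_support n s = {m. Poly_Mapping.keys m \<subseteq> {1..n} \<and> s \<le> card (Poly_Mapping.keys m)}"

lemma large_support_add:
  assumes "u \<in> large_support n s" "Poly_Mapping.keys v \<subseteq> {1..n}"
  shows "u + v \<in> large_support n s"
proof -
  have "card (Poly_Mapping.keys u) \<le> card (Poly_Mapping.keys (u + v))"
    by (intro card_mono) (auto simp: keys_add_nat)
  then show ?thesis using assms by (auto simp: large_support_def keys_add_nat)
qed

text \<open>Pigeonhole: \<open>A\<close> misses some set of \<open>n + 1 - s\<close> indices exactly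
  when its complement, of size \<open>n - card A\<close>, has room for one, that is, when
  \<open>card A < s\<close>.\<close>

lemma large_support_iff_meets:
  assumes "A \<subseteq> {1..n}" "1 \<le> s" "s \<le> n"
  shows "s \<le> card A \<longleftrightarrow> (\<forall>S. S \<subseteq> {1..n} \<and> card S = n + 1 - s \<longrightarrow> A \<inter> S \<noteq> {})"
proof
  have fin: "finite A" using finite_subset[OF assms(1)] by simp
  show "\<forall>S. S \<subseteq> {1..n} \<and> card S = n + 1 - s \<longrightarrow> A \<inter> S \<noteq> {}" if s: "s \<le> card A"
  proof (intro allI impI notI)
    fix S assume S: "S \<subseteq> {1..n} \<and> card S = n + 1 - s" "A \<inter> S = {}"
    then have "finite S" using finite_subset[of S "{1..n}"] by simp
    then have "card (A \<union> S) = card A + (n + 1 - s)"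
      using S(1) card_Un_disjoint[OF fin _ S(2)] by simp
    moreover have "card (A \<union> S) \<le> n"
      using card_mono[of "{1..n}" "A \<union> S"] assms(1) S(1) by simp
    ultimately show False using s assms(3) by linarith
  qed
  show "s \<le> card A" if *: "\<forall>S. S \<subseteq> {1..n} \<and> card S = n + 1 - s \<longrightarrow> A \<inter> S \<noteq> {}"
  proof (rule ccontr)
    assume "\<not> s \<le> card A"
    moreover have "card ({1..n} - A) = n - card A"
      using card_Diff_subset[OF fin assms(1)] by simp
    ultimately have "n + 1 - s \<le> card ({1..n} - A)"
      using assms(2,3) by linarith
    then obtain S where "S \<subseteq> {1..n} - A" "card S = n + 1 - s"
      by (rule obtain_subset_with_card_n)
    then show False using * by blast
  qed
qed

text \<open>An intersection of monomial spans is the span of the common monomials, here those whose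
  support meets every set of \<open>n + 1 - s\<close> indices.\<close>

lemma sqfree_veronese_eq:
  assumes "1 \<le> s" "s \<le> n"
  shows "sqfree_veronese n (n + 1 - s) = monomial_span (large_support n s)"
proof (rule Set.set_eqI)
  fix p :: "'a mpoly"
  let ?Sets = "{S. S \<subseteq> {1..n} \<and> card S = n + 1 - s}"
  have "p \<in> sqfree_veronese n (n + 1 - s) \<longleftrightarrow>
      p \<in> carrier (mpoly_ring n) \<and> (\<forall>S\<in>?Sets. p \<in> var_ideal n S)"
    by (simp add: sqfree_veronese_def Idl_var cong: conj_cong)
  also have "\<dots> \<longleftrightarrow> (\<forall>m\<in>Poly_Mapping.keys p. Poly_Mapping.keys m \<subseteq> {1..n} \<and>
      (\<forall>S\<in>?Sets. Poly_Mapping.keys m \<inter> S \<noteq> {}))"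
    unfolding carrier_mpoly_ring var_ideal_def monomial_span_def by blast
  also have "\<dots> \<longleftrightarrow> p \<in> monomial_span (large_support n s)"
    unfolding monomial_span_def large_support_def
    using large_support_iff_meets[OF _ assms] by (simp add: subset_eq[of "Poly_Mapping.keys p"] cong: conj_cong)
  finally show "p \<in> sqfree_veronese n (n + 1 - s) \<longleftrightarrow> p \<in> monomial_span (large_support n s)" .
qed

section \<open>The permutation action and strong shiftedness\<close>

lemma perm_act_large_support:
  assumes \<sigma>: "\<sigma> permutes {1..n}" and p: "p \<in> monomial_span (large_support n s)"
  shows "perm_act \<sigma> p \<in> monomial_span (large_support n s)"
  unfolding monomial_span_def
proof (intro CollectI subsetI)
  fix m assume "m \<in> Poly_Mapping.keys (perm_act \<sigma> p)"
  then have "Poly_Mapping.map_key \<sigma> m \<in> Poly_Mapping.keys p"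
    by (simp add: perm_act_def keys_map_key[OF inj_map_key[OF permutes_bij[OF \<sigma>]]])
  with p have "Poly_Mapping.map_key \<sigma> m \<in> large_support n s"
    by (auto simp: monomial_span_def)
  \<comment> \<open>The support of \<open>Poly_Mapping.map_key \<sigma> m\<close> is the preimage
    under \<sigma> of the support of \<open>m\<close>, and a bijection preserves its size.\<close>
  then have *: "\<sigma> -` Poly_Mapping.keys m \<subseteq> {1..n}" "s \<le> card (\<sigma> -` Poly_Mapping.keys m)"
    by (auto simp: large_support_def keys_map_key[OF permutes_inj[OF \<sigma>]])
  have "\<sigma> ` (\<sigma> -` Poly_Mapping.keys m) = Poly_Mapping.keys m"
    using permutes_surj[OF \<sigma>] by (rule surj_image_vimage_eq)
  then have "Poly_Mapping.keys m \<subseteq> {1..n}"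
    using image_mono[OF *(1), of \<sigma>] permutes_image[OF \<sigma>] by simp
  moreover have "card (\<sigma> -` Poly_Mapping.keys m) = card (Poly_Mapping.keys m)"
    using permutes_inj[OF \<sigma>] permutes_surj[OF \<sigma>] by (intro card_vimage_inj) auto
  ultimately show "m \<in> large_support n s"
    using *(2) by (simp add: large_support_def)
qed

text \<open>This upgrades the inclusion of images, known for every permutation, to an
  equality.\<close>

lemma perm_act_inverse:
  assumes \<sigma>: "\<sigma> permutes A"
  shows "perm_act \<sigma> (perm_act (inv_into UNIV \<sigma>) p) = p"
proof -
  have bij: "bij \<sigma>" "bij (inv_into UNIV \<sigma>)"
    using permutes_bij[OF \<sigma>] permutes_bij[OF permutes_inv[OF \<sigma>]] .
  have "Poly_Mapping.map_key (inv_into UNIV \<sigma>) \<circ> Poly_Mapping.map_key \<sigma> = (id :: (nat \<Rightarrow>\<^sub>0 nat) \<Rightarrow> _)"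
    using bij permutes_inv_o[OF \<sigma>]
    by (intro ext) (simp add: map_key_compose bij_is_inj map_key_id[folded id_def])
  then show ?thesis
    unfolding perm_act_def
    by (simp add: map_key_compose[OF inj_map_key[OF bij(1)] inj_map_key[OF bij(2)]] map_key_id[folded id_def])
qed

lemma symmetric_large_support:
  "symmetric_monomial_ideal n (monomial_span (large_support n s) :: 'k::field mpoly set)"
  unfolding symmetric_monomial_ideal_def
proof (intro conjI allI impI)
  \<comment> \<open>The set contains all multiples of its members, so it can serve as the generating
    set of its own span.\<close>
  have eq: "{u + v | u v. u \<in> large_support n s \<and> Poly_Mapping.keys v \<subseteq> {1..n}} = large_support n s"
    using large_support_add by (auto intro: exI[of _ 0]) (metis add.right_neutral empty_subsetI keys_zero)
  have keys: "Poly_Mapping.keys m \<subseteq> {1..n}" if "m \<in> large_support n s" for m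
    using that by (simp add: large_support_def)
  show "monomial_ideal n (monomial_span (large_support n s) :: 'k mpoly set)"
    unfolding monomial_ideal_def
  proof (intro exI[of _ "large_support n s"] conjI ballI keys)
    show "monomial_span (large_support n s) = Idl\<^bsub>mpoly_ring n\<^esub> (monom_of ` large_support n s)"
      by (subst Idl_monom_of[OF keys]) (simp_all only: eq)
  qed
next
  fix \<sigma> assume \<sigma>: "\<sigma> permutes {1..n}"
  show "perm_act \<sigma> ` monomial_span (large_support n s) = (monomial_span (large_support n s) :: 'k mpoly set)"
  proof
    show "monomial_span (large_support n s) \<subseteq> perm_act \<sigma> ` (monomial_span (large_support n s) :: 'k mpoly set)"
      using perm_act_inverse[OF \<sigma>] perm_act_large_support[OF permutes_inv[OF \<sigma>]] by (metis imageI subsetI)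
  qed (use perm_act_large_support[OF \<sigma>] in blast)
qed

text \<open>The exchange never shrinks the support. If \<open>i\<close> is already in it, the
  exponent at \<open>j\<close> is at least 2 and \<open>j\<close> stays; otherwise \<open>i\<close>
  is new and makes up for a possible loss of \<open>j\<close>.\<close>

lemma strongly_shifted_large_support:
  "symmetric_strongly_shifted n (monomial_span (large_support n s) :: 'k::field mpoly set)"
  unfolding symmetric_strongly_shifted_def
proof (intro conjI symmetric_large_support ballI allI impI)
  fix m i j
  assume m: "m \<in> partitions_of_ideal n (monomial_span (large_support n s) :: 'k mpoly set)"
    and ij: "1 \<le> i" "i < j" "j \<le> n" "Poly_Mapping.lookup m i < Poly_Mapping.lookup m j"
  let ?w = "m + Poly_Mapping.single i 1 - Poly_Mapping.single j 1"
  have mL: "Poly_Mapping.keys m \<subseteq> {1..n}" "s \<le> card (Poly_Mapping.keys m)"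
    using m by (auto simp: partitions_of_ideal_def large_support_def)
  have w: "Poly_Mapping.lookup ?w k = (if k = i then Poly_Mapping.lookup m i + 1
      else if k = j then Poly_Mapping.lookup m j - 1 else Poly_Mapping.lookup m k)" for k
    using ij by (auto simp: lookup_add lookup_minus lookup_single when_def)
  have sub: "insert i (Poly_Mapping.keys m - {j}) \<subseteq> Poly_Mapping.keys ?w"
    unfolding in_keys_iff subset_iff w by (auto simp: in_keys_iff)
  have "card (Poly_Mapping.keys m) \<le> card (Poly_Mapping.keys ?w)"
  proof (cases "i \<in> Poly_Mapping.keys m")
    case True
    then have "Poly_Mapping.keys m \<subseteq> Poly_Mapping.keys ?w"
      using ij(4) unfolding in_keys_iff subset_iff w by auto
    then show ?thesis by (intro card_mono) auto
  next
    case False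
    have "j \<in> Poly_Mapping.keys m" using ij(4) by (auto simp: in_keys_iff)
    then have "card (Poly_Mapping.keys m) = Suc (card (Poly_Mapping.keys m - {j}))"
      using card_Suc_Diff1[OF finite_keys] by metis
    also have "\<dots> = card (insert i (Poly_Mapping.keys m - {j}))" using False by simp
    also have "\<dots> \<le> card (Poly_Mapping.keys ?w)" using sub by (intro card_mono) auto
    finally show ?thesis .
  qed
  moreover have "Poly_Mapping.keys ?w \<subseteq> {1..n}"
  proof
    fix k assume "k \<in> Poly_Mapping.keys ?w"
    then have "k = i \<or> k = j \<or> k \<in> Poly_Mapping.keys m"
      unfolding in_keys_iff w by (auto split: if_splits)
    then show "k \<in> {1..n}" using mL(1) ij by auto
  qed
  ultimately show "(monom_of ?w :: 'k mpoly) \<in> monomial_span (large_support n s)"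
    using mL(2) by (simp add: large_support_def)
qed

section \<open>Moving supports by permutations\<close>

lemma exists_permutation_image:
  assumes "finite C" "A \<subseteq> C" "B \<subseteq> C" "card A = card B"
  shows "\<exists>\<sigma>. \<sigma> permutes C \<and> \<sigma> ` A = B"
proof -
  have fin: "finite A" "finite B" using assms finite_subset by blast+
  obtain f where f: "bij_betw f A B"
    using finite_same_card_bij[OF fin assms(4)] by blast
  have "card (C - A) = card (C - B)"
    using assms fin by (simp add: card_Diff_subset)
  then obtain g where g: "bij_betw g (C - A) (C - B)"
    using finite_same_card_bij[of "C - A" "C - B"] assms(1) by blast
  \<comment> \<open>A bijection from \<open>A\<close> to \<open>B\<close> is glued to one between
    the complements in \<open>C\<close>, with the identity outside \<open>C\<close>.\<close>
  define \<sigma> where "\<sigma> x = (if x \<in> A then f x else if x \<in> C then g x else x)" for x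
  have "bij_betw \<sigma> A B"
    using f by (subst bij_betw_cong[of A \<sigma> f]) (simp_all add: \<sigma>_def)
  moreover have "bij_betw \<sigma> (C - A) (C - B)"
    using g by (subst bij_betw_cong[of "C - A" \<sigma> g]) (simp_all add: \<sigma>_def)
  ultimately have "bij_betw \<sigma> (A \<union> (C - A)) (B \<union> (C - B))"
    by (rule bij_betw_combine) blast
  then have "\<sigma> permutes C"
    using assms(2,3) by (intro bij_imp_permutes) (auto simp: \<sigma>_def Un_absorb1)
  then show ?thesis using \<open>bij_betw \<sigma> A B\<close> bij_betw_imp_surj_on by blast
qed

text \<open>Symmetry carries one support to every other set of the same size, so a single monomial
  of \<open>I\<close> controls all index sets of that size.\<close>

lemma symmetric_ideal_support:
  fixes I :: "'k::field mpoly set"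
  assumes "symmetric_monomial_ideal n I" "monom_of m \<in> I" "Poly_Mapping.keys m \<subseteq> {1..n}"
    and "S \<subseteq> {1..n}" "card S = card (Poly_Mapping.keys m)"
  shows "\<exists>u. Poly_Mapping.keys u = S \<and> monom_of u \<in> I"
proof -
  obtain \<sigma> where \<sigma>: "\<sigma> permutes {1..n}" "\<sigma> ` Poly_Mapping.keys m = S"
    using exists_permutation_image[of "{1..n}" "Poly_Mapping.keys m" S] assms by auto
  \<comment> \<open>The inverse appears because \<open>perm_act \<sigma>\<close> sends the monomial
    of \<open>Poly_Mapping.map_key \<sigma> u\<close> to that of \<open>u\<close>; the support of
    \<open>u\<close> is then the image under \<sigma> of the support of \<open>m\<close>.\<close>
  define u where "u = Poly_Mapping.map_key (inv_into UNIV \<sigma>) m"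
  have bij: "bij \<sigma>" "bij (inv_into UNIV \<sigma>)"
    using permutes_bij[OF \<sigma>(1)] permutes_bij[OF permutes_inv[OF \<sigma>(1)]] .
  have "Poly_Mapping.map_key \<sigma> u = m"
    using bij permutes_inv_o[OF \<sigma>(1)] by (simp add: u_def map_key_compose bij_is_inj map_key_id[folded id_def])
  then have "monom_of u = perm_act \<sigma> (monom_of m :: 'k mpoly)"
    using perm_act_single[OF \<sigma>(1), of u "1::'k"] by (simp add: monom_of_def)
  then have "monom_of u \<in> I"
    using assms(1,2) \<sigma>(1) unfolding symmetric_monomial_ideal_def by blast
  moreover have "Poly_Mapping.keys u = S"
    unfolding u_def keys_map_key[OF bij_is_inj[OF bij(2)]] \<sigma>(2)[symmetric]
    using bij_vimage_eq_inv_image[OF bij(2)] bij(1) by (simp add: inv_inv_eq)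
  ultimately show ?thesis by blast
qed

section \<open>Radical and height of a symmetric monomial ideal\<close>

theorem proposition2p7:
  fixes n :: nat and I :: "'k::field mpoly set"
  assumes "symmetric_monomial_ideal n I"
    and "I \<noteq> {0}"
    and "I \<noteq> carrier (mpoly_ring n)"
  shows "symmetric_strongly_shifted n (radical (mpoly_ring n) I) \<and>
    (\<exists>c::nat. height (mpoly_ring n) I = enat c \<and>
       radical (mpoly_ring n) I = sqfree_veronese n c)"
proof -
  obtain M where M: "\<And>m. m \<in> M \<Longrightarrow> Poly_Mapping.keys m \<subseteq> {1..n}" "I = Idl\<^bsub>mpoly_ring n\<^esub> (monom_of ` M)"
    using assms(1) unfolding symmetric_monomial_ideal_def monomial_ideal_def by blast
  define U where "U = {u + v | u v. u \<in> M \<and> Poly_Mapping.keys v \<subseteq> {1..n}}"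
  have I: "I = monomial_span U"
    unfolding M(2) U_def using M(1) by (rule Idl_monom_of)
  have ideal: "ideal I (mpoly_ring n)"
    unfolding M(2) using M(1)
    by (intro ring.genideal_ideal[OF ring_mpoly_ring]) (auto simp: carrier_mpoly_ring)
  have keysU: "Poly_Mapping.keys m \<subseteq> {1..n}" if "m \<in> U" for m
    using mpoly_ideal_carrier[OF ideal, of "monom_of m"] that by (simp add: I carrier_mpoly_ring)
  obtain p where "p \<in> I" "p \<noteq> 0"
    using assms(2) mpoly_ideal_0[OF ideal] by blast
  then have "U \<noteq> {}" by (auto simp: I monomial_span_def)
  define s where "s = (LEAST s. \<exists>m\<in>U. card (Poly_Mapping.keys m) = s)"
  have "\<exists>m\<in>U. card (Poly_Mapping.keys m) = s"
    unfolding s_def by (rule LeastI_ex) (use \<open>U \<noteq> {}\<close> in blast)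
  then obtain m0 where m0: "m0 \<in> U" "card (Poly_Mapping.keys m0) = s" by blast
  have s_le: "s \<le> card (Poly_Mapping.keys m)" if "m \<in> U" for m
    unfolding s_def by (rule Least_le) (use that in blast)
  \<comment> \<open>An empty support would put 1 into \<open>I\<close>, contradicting properness;
    hence \<open>s\<close> is at least 1.\<close>
  have "m0 \<noteq> 0"
  proof
    assume "m0 = 0"
    then have "1 \<in> I" using m0(1) by (simp add: I flip: monom_of_0)
    then have "carrier (mpoly_ring n) \<subseteq> I"
      using mpoly_ideal_mult[OF ideal, of _ 1] by auto
    then show False using assms(3) mpoly_ideal_carrier[OF ideal] by blast
  qed
  then have "1 \<le> s" using m0(2) by (auto simp: Suc_le_eq card_gt_0_iff)
  have "s \<le> n" using card_mono[OF _ keysU[OF m0(1)]] m0(2) by simp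
  \<comment> \<open>The least number of variables meeting every \<open>s\<close>-element set: the
    complement of \<open>c\<close> variables has only \<open>s - 1\<close> elements.\<close>
  define c where "c = n + 1 - s"
  have U_large: "U \<subseteq> large_support n s"
    using keysU s_le by (auto simp: large_support_def)
  have support: "\<exists>u. Poly_Mapping.keys u = S \<and> monom_of u \<in> I" if "S \<subseteq> {1..n}" "card S = s" for S
    using symmetric_ideal_support[OF assms(1) _ keysU[OF m0(1)] that(1)] m0 that(2) by (simp add: I)
  have I_sub: "I \<subseteq> var_ideal n T" if "T \<subseteq> {1..n}" "card T = c" for T
  proof -
    have "Poly_Mapping.keys m \<inter> T \<noteq> {}" if "m \<in> U" for m
      using large_support_iff_meets[OF keysU[OF that] \<open>1 \<le> s\<close> \<open>s \<le> n\<close>] s_le[OF that]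
        \<open>T \<subseteq> _\<close> \<open>card T = c\<close> unfolding c_def by blast
    then show ?thesis
      using keysU unfolding I var_ideal_def by (intro monomial_span_mono) blast
  qed

  have radical: "radical (mpoly_ring n) I = monomial_span (large_support n s)"
  proof
    \<comment> \<open>The radical lies in every prime containing \<open>I\<close>, in particular in
      the ideals of \<open>c\<close> variables.\<close>
    have "radical (mpoly_ring n) I \<subseteq> var_ideal n T" if "T \<subseteq> {1..n}" "card T = c" for T
      using radical_subset_prime[OF primeideal_var_ideal I_sub[OF that]] .
    then have "radical (mpoly_ring n) I \<subseteq> sqfree_veronese n c"
      unfolding sqfree_veronese_def by (auto simp: Idl_var radical_def)
    then show "radical (mpoly_ring n) I \<subseteq> monomial_span (large_support n s)"
      unfolding c_def using sqfree_veronese_eq[OF \<open>1 \<le> s\<close> \<open>s \<le> n\<close>] by blast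
    show "monomial_span (large_support n s) \<subseteq> radical (mpoly_ring n) I"
    proof (rule monomial_span_subset_ideal[OF ideal_radical[OF ideal]])
      fix m assume m: "m \<in> large_support n s"
      then have "s \<le> card (Poly_Mapping.keys m)" by (simp add: large_support_def)
      \<comment> \<open>By symmetry the chosen \<open>S\<close> is the support of a monomial in
        \<open>I\<close>, and a power of the monomial of \<open>m\<close> is a multiple of
        it.\<close>
      then obtain S where S: "S \<subseteq> Poly_Mapping.keys m" "card S = s"
        by (rule obtain_subset_with_card_n)
      then obtain u where "Poly_Mapping.keys u = S" "monom_of u \<in> I"
        using support[of S] m by (auto simp: large_support_def)
      then show "monom_of m \<in> radical (mpoly_ring n) I"
        using m S by (intro monom_of_in_radical[OF ideal]) (auto simp: large_support_def)
    qed
  qed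

  have "height (mpoly_ring n) I = enat c"
    unfolding height_def
  proof (rule antisym)
    \<comment> \<open>Any \<open>c\<close> variables would do as the witness prime;
      \<open>1 \<le> s\<close> ensures that there are that many.\<close>
    have c: "{1..c} \<subseteq> {1..n}" "card {1..c} = c" using \<open>1 \<le> s\<close> by (auto simp: c_def)
    have "Inf {prime_height (mpoly_ring n) Q | Q. primeideal Q (mpoly_ring n) \<and> I \<subseteq> Q}
        \<le> prime_height (mpoly_ring n) (var_ideal n {1..c} :: 'k mpoly set)"
      using I_sub[OF c] primeideal_var_ideal by (intro Inf_lower) blast
    also have "\<dots> \<le> enat c" using prime_height_var_ideal_le[OF c(1)] c(2) by simp
    finally show "Inf {prime_height (mpoly_ring n) Q | Q. primeideal Q (mpoly_ring n) \<and> I \<subseteq> Q} \<le> enat c" .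
    show "enat c \<le> Inf {prime_height (mpoly_ring n) Q | Q. primeideal Q (mpoly_ring n) \<and> I \<subseteq> Q}"
    proof (rule Inf_greatest, clarify)
      fix Q assume Q: "primeideal Q (mpoly_ring n)" "I \<subseteq> Q"
      \<comment> \<open>With fewer than \<open>c\<close> variables in \<open>Q\<close>, at least
        \<open>s\<close> would remain outside. Any \<open>s\<close> of these form the support of a
        monomial in \<open>I\<close>, hence in \<open>Q\<close>, and primality puts one of them into
        \<open>Q\<close> after all.\<close>
      define S where "S = {i \<in> {1..n}. (var i :: 'k mpoly) \<in> Q}"
      have "c \<le> card S"
      proof (rule ccontr)
        assume "\<not> c \<le> card S"
        moreover have "card ({1..n} - S) = n - card S"
          using card_Diff_subset[of S "{1..n}"] by (simp add: S_def subset_eq)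
        ultimately have "s \<le> card ({1..n} - S)"
          using \<open>s \<le> n\<close> unfolding c_def by linarith
        then obtain T where T: "T \<subseteq> {1..n} - S" "card T = s"
          by (rule obtain_subset_with_card_n)
        then obtain u where u: "Poly_Mapping.keys u = T" "monom_of u \<in> I"
          using support[of T] by blast
        then obtain i where "i \<in> T" "var i \<in> Q"
          using prime_monom_ofD[OF Q(1), of u] Q(2) T by blast
        then show False using T by (auto simp: S_def)
      qed
      then have "enat c \<le> enat (card S)" by simp
      also have "\<dots> \<le> prime_height (mpoly_ring n) Q"
        by (rule prime_height_ge[OF Q(1)]) (auto simp: S_def)
      finally show "enat c \<le> prime_height (mpoly_ring n) Q" .
    qed
  qed
  then show ?thesis
    using strongly_shifted_large_support sqfree_veronese_eq[OF \<open>1 \<le> s\<close> \<open>s \<le> n\<close>]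
    unfolding radical c_def by blast
qed

end
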